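(* Let $\mu$ and $\nu$ be increasing functions on $[0,\infty)$ and let $\alpha\in(0,\infty)$. Suppose that: (1) for all $t>0$, $r\mapsto e^{-tr}$ belongs to $L^1([0,\infty),d\mu)\cap L^1([0,\infty),d\nu)$; (2) $\nu$ satisfies the doubling condition: there exist constants $C_\nu>0$ and $s_0>0$ such that $\nu(2s)\le C_\nu\,\nu(s)$ for all $s\ge s_0$. Then $$\int_0^\infty e^{-tr}\,d\mu(r)\sim t^{-\alpha}\int_0^\infty e^{-tr}\,d\nu(r)\quad\text{as } t\to0^+$$ implies $$\int_0^\lambda d\mu(r)\sim\frac{1}{\Gamma(\alpha+1)}\int_0^\lambda(\lambda-r)^\alpha\,d\nu(r)\quad\text{as }\lambda\to\infty.$$
   Context: Integrals $d\mu$, $d\nu$ are Lebesgue–Stieltjes integrals with respect to the measures associated with the increasing functions $\mu,\nu$. For positive functions, $f\sim g$ means $f/g\to1$ in the indicated limit. *)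

theory Defs
  imports "HOL-Analysis.Analysis" "HOL-Library.Landau_Symbols"
begin

text \<open>Lebesgue--Stieltjes measure on the real line associated with an increasing
  function mu on [0,infinity): it is the interval measure of the right-continuous
  regularisation of mu, extended by the constant mu 0 to the negative half-line.
  Hence it lives on [0,infinity), gives {a<..b} (0 <= a <= b) the mass mu(b+) - mu(a+),
  and gives the point 0 the mass mu(0+) - mu 0.\<close>
definition LS_measure :: "(real \<Rightarrow> real) \<Rightarrow> real measure" where
  "LS_measure \<mu> = interval_measure (\<lambda>x. if x < 0 then \<mu> 0 else Lim (at_right x) \<mu>)"

end

theory Submission
  imports Defs
begin

text \<open>Convolving \<nu> with the density u^(\<alpha>-1)/\<Gamma>(\<alpha>) on the half-line gives a measure N whose
  Laplace transform is t^(-\<alpha>) times that of \<nu>, and whose mass on [0,L] is the right-hand side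
  of the claim. So the theorem compares two measures with equivalent Laplace transforms, as in
  Karamata's theorem: approximate the indicator of [0,1] by e^(-y) P(e^(-y)) with P a polynomial,
  for which the comparison is immediate. The errors are controlled because N[0,(1+\<epsilon>)L] is close
  to N[0,L]: doubling of \<nu> makes N[0,L] comparable to L^\<alpha> \<nu>[0,2L], while x^\<alpha> is uniformly
  continuous on [0,2].\<close>

section \<open>Laplace transforms of measures on the half-line\<close>

text \<open>No regular variation is assumed, so the ratio of a transform at \<open>k * t\<close> and
  at \<open>t\<close> need not converge, and there is no limit measure to test polynomials against.
  Both measures are therefore tested with the same polynomial and only the difference is estimated;
  transforms decrease, so an error at \<open>k * t\<close> with \<open>k \<ge> 1\<close> that is
  small against the transform there is small against the transform at \<open>t\<close>. The test
  functions carry a factor \<open>exp (- y)\<close>, so an approximation error \<eta> costs \<eta>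
  times the transform of N at \<open>1 / L\<close>. Turning this into a small multiple of N[0,L]
  takes doubling of N itself: N[0,2^k L] grows at most geometrically in k, while the exponential
  weight decays doubly exponentially. The smoothing is essential for the regularity of N: \<nu> may
  have atoms carrying a fixed fraction of its mass, so \<nu>[0,(1+\<epsilon>)L] need not be close to
  \<nu>[0,L].\<close>

locale laplace_measure =
  fixes M :: "real measure"
  assumes sets_eq [measurable_cong, simp]: "sets M = sets borel"
    and integrable_exp: "t > 0 \<Longrightarrow> set_integrable M {0..} (\<lambda>r. exp (- t * r))"
begin

definition laplace :: "real \<Rightarrow> real" where
  "laplace t = (LINT r:{0..}|M. exp (- t * r))"

lemma space_eq [simp]: "space M = UNIV"
  using sets_eq_imp_space_eq[OF sets_eq] by simp

text \<open>Source of integrability for indicators, polynomial test functions and truncated powers: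
  each is written as a damping factor times a bounded function.\<close>

lemma set_integrable_exp_mult:
  assumes "t > 0" and f [measurable]: "f \<in> borel_measurable borel"
    and bound: "\<And>r. r \<ge> 0 \<Longrightarrow> \<bar>f r\<bar> \<le> B"
  shows "set_integrable M {0..} (\<lambda>r. exp (- t * r) * f r)"
  unfolding set_integrable_def
proof (rule Bochner_Integration.integrable_bound)
  show "integrable M (\<lambda>r. B * (indicator {0..} r *\<^sub>R exp (- t * r)))"
    using integrable_exp[OF assms(1)] unfolding set_integrable_def by (rule integrable_mult_right)
  show "AE r in M. norm (indicator {0..} r *\<^sub>R (exp (- t * r) * f r))
      \<le> norm (B * (indicator {0..} r *\<^sub>R exp (- t * r)))"
  proof (rule AE_I2)
    fix r
    show "norm (indicator {0..} r *\<^sub>R (exp (- t * r) * f r))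
      \<le> norm (B * (indicator {0..} r *\<^sub>R exp (- t * r)))"
      using bound[of r] by (auto simp: indicator_def abs_mult mult.commute)
  qed
qed measurable

lemma set_integrable_indicator: "set_integrable M {0..} (indicator {0..L} :: real \<Rightarrow> real)"
proof -
  have "set_integrable M {0..} (\<lambda>r. exp (- 1 * r) * (exp r * indicator {0..L} r))"
    by (rule set_integrable_exp_mult[where B = "exp L"]) (auto simp: indicator_def)
  thus ?thesis by (simp add: exp_minus mult.assoc[symmetric])
qed

lemma set_integral_indicator: "(LINT r:{0..}|M. indicator {0..L} r) = measure M {0..L}"
proof -
  have "(LINT r:{0..}|M. indicator {0..L} r) = integral\<^sup>L M (indicator {0..L} :: real \<Rightarrow> real)"
    unfolding set_lebesgue_integral_def
    by (intro Bochner_Integration.integral_cong) (auto simp: indicator_def)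
  thus ?thesis by simp
qed

lemma emeasure_Icc_finite: "emeasure M {0..L} < \<infinity>"
proof -
  have "integrable M (indicator {0..L} :: real \<Rightarrow> real)"
    using set_integrable_indicator[of L] unfolding set_integrable_def
    by (rule back_subst[where P = "integrable M"]) (auto simp: indicator_def)
  thus ?thesis by (simp add: integrable_indicator_iff)
qed

lemma measure_Icc_mono: "a \<le> b \<Longrightarrow> measure M {0..a} \<le> measure M {0..b}"
  using emeasure_Icc_finite[of b] by (intro measure_mono_fmeasurable) (auto simp: fmeasurable_def)

lemma laplace_nonneg: "laplace t \<ge> 0"
  unfolding laplace_def set_lebesgue_integral_def by (rule integral_nonneg_AE) auto

lemma laplace_antimono:
  assumes "0 < s" "s \<le> t" shows "laplace t \<le> laplace s"
  unfolding laplace_def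
  by (rule set_integral_mono)
     (use assms in \<open>auto simp: mult_right_mono intro!: integrable_exp[of t, simplified] integrable_exp[of s, simplified]\<close>)

text \<open>The bounds are applied at \<open>y = r / L\<close>, which stretches
  \<open>{0..a}\<close> to \<open>{0..a * L}\<close>. The tolerance has the form
  \<open>\<eta> * exp (- y)\<close> because a constant one need not be integrable over
  \<open>{0..}\<close>, whereas this one integrates to
  \<open>\<eta> * laplace (1 / L)\<close>.\<close>

lemma laplace_sandwich:
  assumes f [measurable]: "f \<in> borel_measurable borel" and bound: "\<And>y. y \<ge> 0 \<Longrightarrow> \<bar>f y\<bar> \<le> B"
    and lower: "\<And>y. y \<ge> 0 \<Longrightarrow> indicator {0..a} y - \<eta> * exp (- y) \<le> exp (- y) * f y"
    and upper: "\<And>y. y \<ge> 0 \<Longrightarrow> exp (- y) * f y \<le> indicator {0..b} y + \<eta> * exp (- y)"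
    and L: "L > 0"
  shows "measure M {0..a * L} - \<eta> * laplace (1 / L) \<le> (LINT r:{0..}|M. exp (- (1 / L) * r) * f (1 / L * r))"
    and "(LINT r:{0..}|M. exp (- (1 / L) * r) * f (1 / L * r)) \<le> measure M {0..b * L} + \<eta> * laplace (1 / L)"
proof -
  have ind: "indicator {0..c} (1 / L * r) = (indicator {0..c * L} r :: real)" for c r
    using L by (auto simp: indicator_def field_simps zero_le_divide_iff)
  have int: "set_integrable M {0..} (\<lambda>r. exp (- (1 / L) * r) * f (1 / L * r))"
    by (rule set_integrable_exp_mult[where B = B]) (use L bound in auto)
  have intexp: "set_integrable M {0..} (\<lambda>r. \<eta> * exp (- (1 / L) * r))"
    using integrable_exp[of "1 / L"] L by (intro set_integrable_mult_right) auto
  have "measure M {0..a * L} - \<eta> * laplace (1 / L)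
      = (LINT r:{0..}|M. indicator {0..a * L} r - \<eta> * exp (- (1 / L) * r))"
    unfolding laplace_def
    by (subst set_integral_diff(2)[OF set_integrable_indicator intexp])
       (simp add: set_integral_indicator)
  also have "\<dots> \<le> (LINT r:{0..}|M. exp (- (1 / L) * r) * f (1 / L * r))"
  proof (rule set_integral_mono[OF set_integral_diff(1)[OF set_integrable_indicator intexp] int])
    fix r :: real assume "r \<in> {0..}"
    thus "indicator {0..a * L} r - \<eta> * exp (- (1 / L) * r) \<le> exp (- (1 / L) * r) * f (1 / L * r)"
      using lower[of "1 / L * r"] L by (simp add: ind[symmetric])
  qed
  finally show "measure M {0..a * L} - \<eta> * laplace (1 / L) \<le> (LINT r:{0..}|M. exp (- (1 / L) * r) * f (1 / L * r))" .
  have "(LINT r:{0..}|M. exp (- (1 / L) * r) * f (1 / L * r))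
      \<le> (LINT r:{0..}|M. indicator {0..b * L} r + \<eta> * exp (- (1 / L) * r))"
  proof (rule set_integral_mono[OF int set_integral_add(1)[OF set_integrable_indicator intexp]])
    fix r :: real assume "r \<in> {0..}"
    thus "exp (- (1 / L) * r) * f (1 / L * r) \<le> indicator {0..b * L} r + \<eta> * exp (- (1 / L) * r)"
      using upper[of "1 / L * r"] L by (simp add: ind[symmetric])
  qed
  also have "\<dots> = measure M {0..b * L} + \<eta> * laplace (1 / L)"
    unfolding laplace_def
    by (subst set_integral_add(2)[OF set_integrable_indicator intexp])
       (simp add: set_integral_indicator)
  finally show "(LINT r:{0..}|M. exp (- (1 / L) * r) * f (1 / L * r)) \<le> measure M {0..b * L} + \<eta> * laplace (1 / L)" .
qed

text \<open>The extra factor \<open>exp (- t * r)\<close> raises every exponent by one, so even the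
  constant coefficient meets the transform at a positive argument.\<close>

lemma laplace_polynomial:
  assumes "t > 0"
  shows "(LINT r:{0..}|M. exp (- t * r) * (\<Sum>i\<le>n. c i * exp (- (t * r)) ^ i))
      = (\<Sum>i\<le>n. c i * laplace (real (Suc i) * t))"
proof -
  have eq: "exp (- t * r) * (\<Sum>i\<le>n. c i * exp (- (t * r)) ^ i)
      = (\<Sum>i\<le>n. c i * exp (- (real (Suc i) * t) * r))" for r
    by (auto simp: sum_distrib_left exp_of_nat_mult[symmetric] exp_add[symmetric] algebra_simps
        intro!: sum.cong)
  have int: "set_integrable M {0..} (\<lambda>r. c i * exp (- (real (Suc i) * t) * r))" for i
    using assms by (intro set_integrable_mult_right integrable_exp) auto
  show ?thesis
    unfolding eq set_lebesgue_integral_def laplace_def scaleR_sum_right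
    by (subst Bochner_Integration.integral_sum)
      (use int in \<open>auto simp: set_integrable_def mult.left_commute\<close>)
qed

end

text \<open>In the variable \<open>x = exp (- y)\<close> the two indicators are separated by the
  linear ramp \<open>h\<close>, equal to 0 below \<open>exp (- b)\<close> and to 1 above
  \<open>exp (- a)\<close>; the gap \<open>a < b\<close> makes it continuous. Weierstrass is applied
  to \<open>h x / x\<close>, not to \<open>h\<close>.\<close>

lemma polynomial_sandwich:
  fixes a b \<eta> :: real
  assumes "0 < a" "a < b" "\<eta> > 0"
  obtains c :: "nat \<Rightarrow> real" and n where
    "\<And>y. y \<ge> 0 \<Longrightarrow> indicator {0..a} y - \<eta> * exp (- y) \<le> exp (- y) * (\<Sum>i\<le>n. c i * exp (- y) ^ i)"
    "\<And>y. y \<ge> 0 \<Longrightarrow> exp (- y) * (\<Sum>i\<le>n. c i * exp (- y) ^ i) \<le> indicator {0..b} y + \<eta> * exp (- y)"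
proof -
  define h where "h = (\<lambda>x. max 0 (min 1 ((x - exp (- b)) / (exp (- a) - exp (- b)))))"
  define g where "g = (\<lambda>x. h x / max x (exp (- b)))"
  have ab: "exp (- a) - exp (- b) > 0" using assms by simp
  \<comment> \<open>\<open>h\<close> vanishes for \<open>x \<le> exp (- b)\<close>, so the \<open>max\<close> only serves continuity of \<open>g\<close> at \<open>0\<close>.\<close>
  have gh: "x * g x = h x" for x
    using ab assms(2) order.trans[of "exp (- a)" x "exp (- b)"]
    by (auto simp: g_def h_def max_def min_def divide_nonpos_pos zero_le_divide_iff)
  have "continuous_on {0..1} g"
    unfolding g_def h_def using ab by (intro continuous_intros) (auto simp: max_def)
  from Stone_Weierstrass_real_polynomial_function[OF compact_Icc this assms(3)]
  obtain p where p: "real_polynomial_function p" "\<And>x. x \<in> {0..1} \<Longrightarrow> \<bar>g x - p x\<bar> < \<eta>"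
    by blast
  obtain c n where pc: "p = (\<lambda>x. \<Sum>i\<le>n. c i * x ^ i)"
    using p(1) unfolding real_polynomial_function_iff_sum by blast
  \<comment> \<open>Multiplying the uniform error \<eta> by \<open>x = exp (- y)\<close> restores
    \<open>h\<close> and produces the decaying tolerance.\<close>
  have close: "\<bar>h (exp (- y)) - exp (- y) * p (exp (- y))\<bar> \<le> \<eta> * exp (- y)" if "y \<ge> 0" for y
  proof -
    have "\<bar>h (exp (- y)) - exp (- y) * p (exp (- y))\<bar> = exp (- y) * \<bar>g (exp (- y)) - p (exp (- y))\<bar>"
      unfolding gh[symmetric] by (simp add: right_diff_distrib[symmetric] abs_mult)
    also have "\<dots> \<le> exp (- y) * \<eta>"
      using p(2)[of "exp (- y)"] that by (intro mult_left_mono) auto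
    finally show ?thesis by (simp add: mult.commute)
  qed
  have h1: "indicator {0..a} y \<le> h (exp (- y))" for y
    using ab by (auto simp: h_def indicator_def)
  have h2: "h (exp (- y)) \<le> indicator {0..b} y" if "y \<ge> 0" for y
    using ab that by (auto simp: h_def indicator_def divide_nonpos_pos)
  show thesis
  proof
    fix y :: real assume y: "y \<ge> 0"
    show "indicator {0..a} y - \<eta> * exp (- y) \<le> exp (- y) * (\<Sum>i\<le>n. c i * exp (- y) ^ i)"
      using close[OF y] h1[of y] unfolding pc by linarith
    show "exp (- y) * (\<Sum>i\<le>n. c i * exp (- y) ^ i) \<le> indicator {0..b} y + \<eta> * exp (- y)"
      using close[OF y] h2[OF y] unfolding pc by linarith
  qed
qed

section \<open>Comparison of measures with equivalent Laplace transforms\<close>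

text \<open>Passing from \<open>k = n\<close> to \<open>Suc n\<close> multiplies the term by
  \<open>C * exp (- (2 ^ n / 2))\<close> in absolute value. The starting index comes from the crude
  chain \<open>n \<le> 2 ^ n\<close> and \<open>x \<le> exp x\<close>.\<close>

lemma summable_double_exp: "summable (\<lambda>k. exp (1 - 2 ^ k / 2) * C ^ k :: real)"
proof (rule summable_ratio_test[where c = "1/2" and N = "nat \<lceil>4 * \<bar>C\<bar>\<rceil>"])
  fix n assume n: "nat \<lceil>4 * \<bar>C\<bar>\<rceil> \<le> n"
  have "2 * \<bar>C\<bar> \<le> real n / 2" using n by linarith
  also have "\<dots> \<le> 2 ^ n / 2" using of_nat_less_two_power[of n, where 'a = real] by simp
  also have "\<dots> \<le> exp (2 ^ n / 2)" using exp_ge_add_one_self[of "2 ^ n / 2 :: real"] by linarith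
  finally have "\<bar>C\<bar> * exp (- (2 ^ n / 2)) \<le> 1 / 2"
    by (simp add: exp_minus field_simps)
  moreover have "norm (exp (1 - 2 ^ Suc n / 2) * C ^ Suc n)
      = (\<bar>C\<bar> * exp (- (2 ^ n / 2))) * norm (exp (1 - 2 ^ n / 2) * C ^ n)"
  proof -
    have "exp (1 - 2 ^ Suc n / 2 :: real) = exp (- (2 ^ n / 2)) * exp (1 - 2 ^ n / 2)"
      by (simp add: exp_add[symmetric])
    thus ?thesis by (simp add: abs_mult)
  qed
  ultimately show "norm (exp (1 - 2 ^ Suc n / 2) * C ^ Suc n) \<le> 1 / 2 * norm (exp (1 - 2 ^ n / 2) * C ^ n)"
    by (metis mult_right_mono norm_ge_zero)
qed simp

text \<open>The weights come from exp (- y) \<le> exp (1 - 2^k/2) for y > 2^(k-1), or k = 0.\<close>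

lemma exp_le_dyadic_suminf:
  assumes "y \<ge> 0"
  shows "ennreal (exp (- y)) \<le> (\<Sum>k. ennreal (exp (1 - 2 ^ k / 2)) * indicator {0..2 ^ k} y)"
proof -
  define k where "k = (LEAST k. y \<le> 2 ^ k)"
  have "\<exists>k. y \<le> 2 ^ k"
    using real_arch_pow[of 2 y] by (auto intro: less_imp_le)
  hence k: "y \<le> 2 ^ k" unfolding k_def by (rule LeastI_ex)
  have "2 ^ k / 2 \<le> 1 + y"
  proof (cases k)
    case (Suc j)
    hence "\<not> y \<le> 2 ^ j" using not_less_Least[of j "\<lambda>k. y \<le> 2 ^ k"] unfolding k_def by simp
    thus ?thesis using Suc by simp
  qed (use assms in auto)
  hence "ennreal (exp (- y)) \<le> ennreal (exp (1 - 2 ^ k / 2)) * indicator {0..2 ^ k} y"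
    using k assms by (auto intro!: ennreal_leI)
  also have "\<dots> \<le> (\<Sum>k. ennreal (exp (1 - 2 ^ k / 2)) * indicator {0..2 ^ k} y)"
    using sum_le_suminf[OF summableI, of "{k}" "\<lambda>k. ennreal (exp (1 - 2 ^ k / 2)) * indicator {0..2 ^ k} y"]
    by (simp del: sum_mult_indicator)
  finally show ?thesis .
qed

context laplace_measure
begin

lemma ennreal_laplace:
  assumes "t > 0"
  shows "ennreal (laplace t) = (\<integral>\<^sup>+r. ennreal (indicator {0..} r * exp (- t * r)) \<partial>M)"
  using integrable_exp[OF assms] unfolding laplace_def set_lebesgue_integral_def set_integrable_def
  by (subst nn_integral_eq_integral) auto

text \<open>Iterated doubling costs \<open>C ^ k\<close> on \<open>{0..2 ^ k * L}\<close>, and the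
  dyadic majorant of the exponential pays for it; \<open>K\<close> is the sum of the resulting
  weights. Working in \<open>ennreal\<close> lets sum and integral be exchanged freely.\<close>

lemma laplace_le_measure:
  assumes "L0 > 0" "C > 0"
    and doubling: "\<And>L. L \<ge> L0 \<Longrightarrow> measure M {0..2 * L} \<le> C * measure M {0..L}"
  obtains K where "K > 0" "\<And>L. L \<ge> L0 \<Longrightarrow> laplace (1 / L) \<le> K * measure M {0..L}"
proof
  define w where "w = (\<lambda>k. exp (1 - 2 ^ k / 2) * C ^ k :: real)"
  have sw: "summable w" unfolding w_def by (rule summable_double_exp)
  have w: "w k > 0" for k using assms by (simp add: w_def)
  show "suminf w > 0" using sw w by (rule suminf_pos)
  fix L assume L: "L \<ge> L0"
  have pow: "measure M {0..2 ^ k * L} \<le> C ^ k * measure M {0..L}" for k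
  proof (induction k)
    case (Suc k)
    have "1 * L0 \<le> 2 ^ k * L" using L assms(1) by (intro mult_mono) auto
    hence "measure M {0..2 * (2 ^ k * L)} \<le> C * measure M {0..2 ^ k * L}"
      by (intro doubling) simp
    also have "\<dots> \<le> C * (C ^ k * measure M {0..L})" using Suc assms by (intro mult_left_mono) auto
    finally show ?case by (simp add: mult.assoc)
  qed simp
  have Lpos: "L > 0" using L assms by simp
  have "ennreal (laplace (1 / L)) = (\<integral>\<^sup>+r. ennreal (indicator {0..} r * exp (- (1 / L) * r)) \<partial>M)"
    using Lpos by (intro ennreal_laplace) auto
  also have "\<dots> \<le> (\<integral>\<^sup>+r. (\<Sum>k. ennreal (exp (1 - 2 ^ k / 2)) * indicator {0..2 ^ k * L} r) \<partial>M)"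
  proof (rule nn_integral_mono)
    fix r
    have "indicator {0..2 ^ k} (r / L) = (indicator {0..2 ^ k * L} r :: ennreal)" for k
      using Lpos by (auto simp: indicator_def field_simps zero_le_divide_iff)
    thus "ennreal (indicator {0..} r * exp (- (1 / L) * r))
        \<le> (\<Sum>k. ennreal (exp (1 - 2 ^ k / 2)) * indicator {0..2 ^ k * L} r)"
      using exp_le_dyadic_suminf[of "r / L"] Lpos by (cases "r \<ge> 0") auto
  qed
  also have "\<dots> = (\<Sum>k. ennreal (exp (1 - 2 ^ k / 2)) * emeasure M {0..2 ^ k * L})"
    by (subst nn_integral_suminf) (auto simp: nn_integral_cmult)
  also have "\<dots> \<le> (\<Sum>k. ennreal (w k * measure M {0..L}))"
  proof (intro suminf_le allI summableI)
    fix k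
    have "ennreal (exp (1 - 2 ^ k / 2)) * emeasure M {0..2 ^ k * L}
        = ennreal (exp (1 - 2 ^ k / 2) * measure M {0..2 ^ k * L})"
      using emeasure_Icc_finite[of "2 ^ k * L"]
      by (simp add: ennreal_mult' emeasure_eq_ennreal_measure)
    also have "\<dots> \<le> ennreal (w k * measure M {0..L})"
      unfolding w_def mult.assoc by (intro ennreal_leI mult_left_mono pow) auto
    finally show "ennreal (exp (1 - 2 ^ k / 2)) * emeasure M {0..2 ^ k * L}
        \<le> ennreal (w k * measure M {0..L})" .
  qed
  also have "\<dots> = ennreal (suminf w * measure M {0..L})"
    using sw w by (subst suminf_ennreal2) (auto simp: suminf_mult2 summable_mult2 less_imp_le)
  finally show "laplace (1 / L) \<le> suminf w * measure M {0..L}"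
    by (subst (asm) ennreal_le_iff) (use suminf_pos[OF sw w] in auto)
qed

end

text \<open>One polynomial is squeezed between the indicators for both measures, and its two
  integrals differ by little. Errors stay in units of the transform of \<open>N\<close>, to be
  converted into mass later. The endpoints are general because the pairs 1, 1 + \<epsilon> and 1 /
  (1 + \<epsilon>), 1 are both needed.\<close>

lemma laplace_comparison:
  assumes "laplace_measure M" "laplace_measure N"
    and asymp: "(\<lambda>t. laplace_measure.laplace M t - laplace_measure.laplace N t)
      \<in> o[at_right 0](laplace_measure.laplace N)"
    and ab: "0 < a" "a < b" and \<eta>: "\<eta> > 0"
  shows "\<forall>\<^sub>F L in at_top.
      measure M {0..a * L} \<le> measure N {0..b * L} + \<eta> * laplace_measure.laplace N (1 / L) \<and>
      measure N {0..a * L} \<le> measure M {0..b * L} + \<eta> * laplace_measure.laplace N (1 / L)"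
proof -
  interpret M: laplace_measure M by fact
  interpret N: laplace_measure N by fact
  \<comment> \<open>Four quarters are spent: one on the sandwich for \<open>N\<close>, one on the
    difference of the polynomial integrals, and two on the sandwich for \<open>M\<close>, whose
    transform is eventually at most twice that of \<open>N\<close>.\<close>
  obtain c n where
    c: "\<And>y. y \<ge> 0 \<Longrightarrow> indicator {0..a} y - \<eta> / 4 * exp (- y) \<le> exp (- y) * (\<Sum>i\<le>n. c i * exp (- y) ^ i)"
       "\<And>y. y \<ge> 0 \<Longrightarrow> exp (- y) * (\<Sum>i\<le>n. c i * exp (- y) ^ i) \<le> indicator {0..b} y + \<eta> / 4 * exp (- y)"
    using polynomial_sandwich[OF ab, of "\<eta> / 4"] \<eta> by auto
  \<comment> \<open>\<open>A F t\<close> is the integral of the polynomial test function, seen as a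
    function of the transform \<open>F\<close> alone.\<close>
  define A where "A = (\<lambda>F t. \<Sum>i\<le>n. c i * F (real (Suc i) * t) :: real)"
  have bound: "\<bar>\<Sum>i\<le>n. c i * exp (- y) ^ i\<bar> \<le> (\<Sum>i\<le>n. \<bar>c i\<bar>)" if "y \<ge> 0" for y :: real
  proof (rule order.trans[OF sum_abs sum_mono])
    fix i
    have "exp (- y) ^ i \<le> 1" using that by (intro power_le_one) auto
    thus "\<bar>c i * exp (- y) ^ i\<bar> \<le> \<bar>c i\<bar>" by (simp add: abs_mult mult_left_le)
  qed
  have sandwich: "measure X {0..a * L} - \<eta> / 4 * laplace_measure.laplace X (1 / L) \<le> A (laplace_measure.laplace X) (1 / L)"
    "A (laplace_measure.laplace X) (1 / L) \<le> measure X {0..b * L} + \<eta> / 4 * laplace_measure.laplace X (1 / L)"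
    if "laplace_measure X" "L > 0" for X L
  proof -
    interpret X: laplace_measure X by fact
    have "(\<lambda>y. \<Sum>i\<le>n. c i * exp (- y) ^ i) \<in> borel_measurable borel" by measurable
    note * = X.laplace_sandwich[OF this bound c \<open>L > 0\<close>]
      X.laplace_polynomial[of "1 / L" c n]
    show "measure X {0..a * L} - \<eta> / 4 * laplace_measure.laplace X (1 / L) \<le> A (laplace_measure.laplace X) (1 / L)"
      "A (laplace_measure.laplace X) (1 / L) \<le> measure X {0..b * L} + \<eta> / 4 * laplace_measure.laplace X (1 / L)"
      using * \<open>L > 0\<close> unfolding A_def by auto
  qed
  \<comment> \<open>Monotonicity of the transform of \<open>N\<close> replaces regular variation
    here; it applies because the dilation factors \<open>Suc i\<close> are at least 1.\<close>
  have dilate: "(\<lambda>t. M.laplace (k * t) - N.laplace (k * t)) \<in> o[at_right 0](N.laplace)"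
    if "k \<ge> 1" for k :: real
  proof (rule landau_o.smallI)
    fix d :: real assume d: "d > 0"
    from landau_o.smallD[OF asymp d] obtain s where s: "s > 0"
      "\<And>t. 0 < t \<Longrightarrow> t < s \<Longrightarrow> \<bar>M.laplace t - N.laplace t\<bar> \<le> d * N.laplace t"
      unfolding eventually_at_right_field by (auto simp: N.laplace_nonneg)
    show "\<forall>\<^sub>F t in at_right 0. norm (M.laplace (k * t) - N.laplace (k * t)) \<le> d * norm (N.laplace t)"
      unfolding eventually_at_right_field
    proof (intro exI[of _ "s / k"] conjI allI impI)
      fix t assume t: "0 < t" "t < s / k"
      have "\<bar>M.laplace (k * t) - N.laplace (k * t)\<bar> \<le> d * N.laplace (k * t)"
        using t that by (intro s(2)) (auto simp: field_simps)
      also have "\<dots> \<le> d * N.laplace t"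
        using t that d by (intro mult_left_mono N.laplace_antimono) auto
      finally show "norm (M.laplace (k * t) - N.laplace (k * t)) \<le> d * norm (N.laplace t)"
        by (simp add: N.laplace_nonneg)
    qed (use s that in auto)
  qed
  have diff: "(\<lambda>t. A M.laplace t - A N.laplace t) \<in> o[at_right 0](N.laplace)"
    unfolding A_def sum_subtractf[symmetric] right_diff_distrib[symmetric]
  proof (rule big_sum_in_smallo)
    fix i
    show "(\<lambda>t. c i * (M.laplace (real (Suc i) * t) - N.laplace (real (Suc i) * t))) \<in> o[at_right 0](N.laplace)"
      using dilate[of "real (Suc i)"] by (cases "c i = 0") auto
  qed
  have inv: "filterlim (\<lambda>L::real. 1 / L) (at_right 0) at_top"
    using filterlim_inverse_at_right_top by (simp add: inverse_eq_divide)
  have "\<forall>\<^sub>F L in at_top. \<bar>A M.laplace (1 / L) - A N.laplace (1 / L)\<bar> \<le> \<eta> / 4 * N.laplace (1 / L)"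
    using eventually_compose_filterlim[OF landau_o.smallD[OF diff, of "\<eta> / 4"] inv] \<eta>
    by (simp add: N.laplace_nonneg)
  moreover have "\<forall>\<^sub>F L in at_top. \<bar>M.laplace (1 / L) - N.laplace (1 / L)\<bar> \<le> 1 * N.laplace (1 / L)"
    using eventually_compose_filterlim[OF landau_o.smallD[OF asymp, of 1] inv]
    by (simp add: N.laplace_nonneg)
  ultimately show ?thesis
    using eventually_gt_at_top[of 0]
  proof eventually_elim
    case (elim L)
    have "M.laplace (1 / L) \<le> 2 * N.laplace (1 / L)" using elim(2) by linarith
    hence "\<eta> / 4 * M.laplace (1 / L) \<le> \<eta> / 4 * (2 * N.laplace (1 / L))"
      using \<eta> by (intro mult_left_mono) auto
    hence m: "\<eta> / 4 * M.laplace (1 / L) \<le> 2 * (\<eta> / 4 * N.laplace (1 / L))" by simp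
    have e: "\<eta> * N.laplace (1 / L) = 4 * (\<eta> / 4 * N.laplace (1 / L))" by simp
    show ?case
      unfolding e using m elim(1) sandwich[OF \<open>laplace_measure M\<close> \<open>L > 0\<close>]
        sandwich[OF \<open>laplace_measure N\<close> \<open>L > 0\<close>] by linarith
  qed
qed

text \<open>The upper bound compares \<open>M\<close> on \<open>{0..L}\<close> with \<open>N\<close>
  on \<open>{0..(1 + \<epsilon>) * L}\<close>, the lower bound with \<open>N\<close> on
  \<open>{0..q * L}\<close>. Regularity of \<open>N\<close> moves both endpoints back to
  \<open>L\<close>, and doubling turns the transform error into mass.\<close>

lemma ratio_tauberian:
  assumes M: "laplace_measure M" and N: "laplace_measure N"
    and asymp: "laplace_measure.laplace M \<sim>[at_right 0] laplace_measure.laplace N"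
    and reg: "\<And>\<delta>. \<delta> > 0 \<Longrightarrow> \<exists>\<epsilon>>0. \<forall>\<^sub>F L in at_top. measure N {0..(1 + \<epsilon>) * L} \<le> (1 + \<delta>) * measure N {0..L}"
    and doubling: "\<exists>C>0. \<forall>\<^sub>F L in at_top. measure N {0..2 * L} \<le> C * measure N {0..L}"
  shows "(\<lambda>L. measure M {0..L}) \<sim>[at_top] (\<lambda>L. measure N {0..L})"
  unfolding asymp_equiv_altdef
proof (rule landau_o.smallI)
  interpret N: laplace_measure N by fact
  fix c :: real assume c: "c > 0"
  obtain C L0 where "C > 0" "\<And>L. L \<ge> L0 \<Longrightarrow> measure N {0..2 * L} \<le> C * measure N {0..L}"
    using doubling unfolding eventually_at_top_linorder by blast
  then obtain K where K: "K > 0" "\<And>L. L \<ge> max 1 L0 \<Longrightarrow> N.laplace (1 / L) \<le> K * measure N {0..L}"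
    using N.laplace_le_measure[of "max 1 L0" C]
    by (metis max.bounded_iff less_max_iff_disj zero_less_one)
  obtain \<epsilon> where \<epsilon>: "\<epsilon> > 0" "\<forall>\<^sub>F L in at_top. measure N {0..(1 + \<epsilon>) * L} \<le> (1 + c / 2) * measure N {0..L}"
    using reg[of "c / 2"] c by auto
  \<comment> \<open>Half of the tolerance \<open>c\<close> goes to moving the endpoint, the other
    half to the transform error, which is at most \<open>\<eta> * K\<close> times the mass.\<close>
  define \<eta> where "\<eta> = c / (2 * K)"
  have \<eta>: "\<eta> > 0" "\<eta> * K = c / 2" using c K by (auto simp: \<eta>_def)
  \<comment> \<open>Regularity at \<open>q * L\<close> bounds the mass on \<open>{0..L}\<close> by
    that on \<open>{0..q * L}\<close>.\<close>
  define q where "q = 1 / (1 + \<epsilon>)"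
  have q: "0 < q" "q < 1" "(1 + \<epsilon>) * (q * L) = L" for L using \<epsilon>(1) by (auto simp: q_def field_simps)
  have "filterlim (\<lambda>L. q * L) at_top at_top"
    using q by (intro filterlim_tendsto_pos_mult_at_top[OF tendsto_const _ filterlim_ident]) auto
  from eventually_compose_filterlim[OF \<epsilon>(2) this]
  have "\<forall>\<^sub>F L in at_top. measure N {0..L} \<le> (1 + c / 2) * measure N {0..q * L}"
    by (simp only: q(3))
  moreover note \<epsilon>(2) eventually_ge_at_top[of "max 1 L0"]
    laplace_comparison[OF M N asymp[unfolded asymp_equiv_altdef] zero_less_one less_add_same_cancel1[THEN iffD2, OF \<epsilon>(1)] \<eta>(1)]
    laplace_comparison[OF M N asymp[unfolded asymp_equiv_altdef] q(1,2) \<eta>(1)]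
  ultimately show "\<forall>\<^sub>F L in at_top. norm (measure M {0..L} - measure N {0..L}) \<le> c * norm (measure N {0..L})"
  proof (eventually_elim)
    case (elim L)
    have "\<eta> * N.laplace (1 / L) \<le> \<eta> * (K * measure N {0..L})"
      using \<eta> K(2)[OF elim(3)] by (intro mult_left_mono) auto
    hence F: "\<eta> * N.laplace (1 / L) \<le> c / 2 * measure N {0..L}"
      by (simp add: mult.assoc[symmetric] \<eta>(2))
    have "measure N {0..q * L} \<le> measure N {0..L}"
      using q elim(3) by (intro N.measure_Icc_mono) (auto simp: mult_left_le_one_le)
    hence "c / 2 * measure N {0..q * L} \<le> c / 2 * measure N {0..L}" 
      using c by (intro mult_left_mono) auto
    thus ?case using elim F \<epsilon>(1) \<eta>(1) q by (auto simp: abs_le_iff algebra_simps)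
  qed
qed

section \<open>Fractional integrals of a measure\<close>

text \<open>Kernel of the Riemann--Liouville integral of order \<alpha>. At \<open>u = 0\<close> the
  value is 0 since \<open>0 powr x = 0\<close>, even when the kernel is unbounded near 0.\<close>

abbreviation riesz_kernel :: "real \<Rightarrow> real \<Rightarrow> real" where
  "riesz_kernel \<alpha> u \<equiv> indicator {0..} u * u powr (\<alpha> - 1) / Gamma \<alpha>"

text \<open>Euler's integral for \<open>Gamma \<alpha>\<close> after the substitution
  \<open>v = t * u\<close>.\<close>

lemma nn_integral_riesz_kernel_exp:
  assumes "\<alpha> > 0" "t > 0"
  shows "(\<integral>\<^sup>+u. ennreal (riesz_kernel \<alpha> u) * ennreal (exp (- t * u)) \<partial>lborel)
    = ennreal (t powr (- \<alpha>))"
proof -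
  have G: "Gamma \<alpha> > 0" using assms by (simp add: Gamma_real_pos)
  have "ennreal (Gamma \<alpha>) = (\<integral>\<^sup>+v. ennreal (indicator {0..} v * v powr (\<alpha> - 1) / exp v) \<partial>lborel)"
    using assms(1) by (rule Gamma_conv_nn_integral_real)
  also have "\<dots> = ennreal \<bar>t\<bar> * (\<integral>\<^sup>+u. ennreal (indicator {0..} (0 + t * u) * (0 + t * u) powr (\<alpha> - 1) / exp (0 + t * u)) \<partial>lborel)"
    by (rule nn_integral_real_affine) (use assms in auto)
  also have "(\<integral>\<^sup>+u. ennreal (indicator {0..} (0 + t * u) * (0 + t * u) powr (\<alpha> - 1) / exp (0 + t * u)) \<partial>lborel)
    = (\<integral>\<^sup>+u. ennreal (t powr (\<alpha> - 1) * Gamma \<alpha>) *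
        (ennreal (riesz_kernel \<alpha> u) * ennreal (exp (- t * u))) \<partial>lborel)"
  proof (rule nn_integral_cong)
    fix u :: real
    have "indicator {0..} (0 + t * u) * (0 + t * u) powr (\<alpha> - 1) / exp (0 + t * u)
      = t powr (\<alpha> - 1) * g * (indicator {0..} u * u powr (\<alpha> - 1) / g * exp (- t * u))"
      if "g > 0" for g :: real
      using assms that by (auto simp: indicator_def powr_mult exp_minus field_simps zero_le_mult_iff)
    from this[OF G] show "ennreal (indicator {0..} (0 + t * u) * (0 + t * u) powr (\<alpha> - 1) / exp (0 + t * u))
      = ennreal (t powr (\<alpha> - 1) * Gamma \<alpha>) * (ennreal (riesz_kernel \<alpha> u) * ennreal (exp (- t * u)))"
      using G by (simp only: ennreal_mult''[OF exp_ge_zero, symmetric] ennreal_mult'[symmetric]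
          mult_nonneg_nonneg powr_ge_zero less_imp_le)
  qed
  also have "\<dots> = ennreal (t powr (\<alpha> - 1) * Gamma \<alpha>) * (\<integral>\<^sup>+u. ennreal (riesz_kernel \<alpha> u) * ennreal (exp (- t * u)) \<partial>lborel)"
    by (rule nn_integral_cmult) measurable
  finally have eq: "ennreal (Gamma \<alpha>) = ennreal (t powr \<alpha> * Gamma \<alpha>) * (\<integral>\<^sup>+u. ennreal (riesz_kernel \<alpha> u) * ennreal (exp (- t * u)) \<partial>lborel)"
    using assms G by (simp add: mult.assoc[symmetric] ennreal_mult'[symmetric] powr_diff)
  \<comment> \<open>Instead of dividing in \<open>ennreal\<close>, \<open>eq\<close> is multiplied
    by a finite factor that makes the coefficient of the integral 1.\<close>
  have "ennreal (t powr (- \<alpha>)) = ennreal (t powr (- \<alpha>) / Gamma \<alpha>) * ennreal (Gamma \<alpha>)"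
    using G by (simp add: ennreal_mult'[symmetric])
  also have "\<dots> = ennreal (t powr (- \<alpha>) / Gamma \<alpha> * (t powr \<alpha> * Gamma \<alpha>)) * (\<integral>\<^sup>+u. ennreal (riesz_kernel \<alpha> u) * ennreal (exp (- t * u)) \<partial>lborel)"
    by (subst eq, subst mult.assoc[symmetric], subst ennreal_mult') (use G in auto)
  also have "t powr (- \<alpha>) / Gamma \<alpha> * (t powr \<alpha> * Gamma \<alpha>) = 1"
    using assms(2) G by (simp add: powr_minus field_simps)
  finally show ?thesis by simp
qed

text \<open>Integrating the power gives a factor \<open>1 / \<alpha>\<close>, and
  \<open>\<alpha> * Gamma \<alpha> = Gamma (\<alpha> + 1)\<close>: this is the constant of the
  theorem.\<close>

lemma nn_integral_riesz_kernel_Icc: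
  assumes "\<alpha> > 0" "r \<ge> 0"
  shows "(\<integral>\<^sup>+u. ennreal (riesz_kernel \<alpha> u) * indicator {0..L} (r + u) \<partial>lborel)
    = ennreal (max 0 (L - r) powr \<alpha> / Gamma (\<alpha> + 1))"
proof (cases "r \<le> L")
  case True
  have G: "Gamma \<alpha> > 0" "Gamma (\<alpha> + 1) = \<alpha> * Gamma \<alpha>"
    using assms(1) Gamma_real_pos[of \<alpha>] Gamma_plus1[of \<alpha>] nonpos_Ints_nonpos[of \<alpha>]
    by linarith+
  have "((\<lambda>u. u powr (\<alpha> - 1)) has_integral ((L - r) powr \<alpha> / \<alpha>)) {0..L - r}"
    using has_integral_powr_from_0[of "\<alpha> - 1" "L - r"] assms True by simp
  hence "((\<lambda>u. u powr (\<alpha> - 1) / Gamma \<alpha>) has_integral ((L - r) powr \<alpha> / \<alpha> / Gamma \<alpha>)) {0..L - r}"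
    by (rule has_integral_divide)
  from nn_integral_has_integral_lebesgue'[OF _ this] G(1)
  have "(\<integral>\<^sup>+u. ennreal (u powr (\<alpha> - 1) / Gamma \<alpha>) * indicator {0..L - r} u \<partial>lborel)
      = ennreal ((L - r) powr \<alpha> / \<alpha> / Gamma \<alpha>)" by simp
  also have "(\<integral>\<^sup>+u. ennreal (u powr (\<alpha> - 1) / Gamma \<alpha>) * indicator {0..L - r} u \<partial>lborel)
    = (\<integral>\<^sup>+u. ennreal (riesz_kernel \<alpha> u) * indicator {0..L} (r + u) \<partial>lborel)"
    using assms by (intro nn_integral_cong) (auto simp: indicator_def)
  finally show ?thesis using True G(2) by simp
next
  case False
  hence "(\<integral>\<^sup>+u. ennreal (riesz_kernel \<alpha> u) * indicator {0..L} (r + u) \<partial>lborel) = (\<integral>\<^sup>+(u::real). 0 \<partial>lborel)"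
    by (intro nn_integral_cong) (auto simp: indicator_def)
  thus ?thesis using False by simp
qed

text \<open>Convolution of the restriction of \<open>M\<close> to \<open>{0..}\<close> with the
  kernel, as the image under addition of a density on the product. Lebesgue measure is the second
  factor because Tonelli in this order asks sigma-finiteness of that factor only, and the locale
  does not state it for \<open>M\<close>.\<close>

definition fractional_integral :: "real \<Rightarrow> real measure \<Rightarrow> real measure" where
  "fractional_integral \<alpha> M = distr
     (density (M \<Otimes>\<^sub>M lborel)
       (\<lambda>(r, u). indicator {0..} r * ennreal (riesz_kernel \<alpha> u)))
     borel (\<lambda>(r, u). r + u)"

context laplace_measure
begin

lemma nn_integral_fractional_integral:
  assumes [measurable]: "f \<in> borel_measurable borel"
  shows "(\<integral>\<^sup>+x. f x \<partial>fractional_integral \<alpha> M)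
    = (\<integral>\<^sup>+r. indicator {0..} r * (\<integral>\<^sup>+u. ennreal (riesz_kernel \<alpha> u) * f (r + u) \<partial>lborel) \<partial>M)"
  unfolding fractional_integral_def
  by (subst nn_integral_distr, measurable, subst nn_integral_density, measurable,
      subst lborel.nn_integral_fst[symmetric], measurable)
     (simp add: mult.assoc nn_integral_cmult)

lemma nn_integral_exp_fractional_integral:
  assumes "\<alpha> > 0" "t > 0"
  shows "(\<integral>\<^sup>+x. ennreal (indicator {0..} x * exp (- t * x)) \<partial>fractional_integral \<alpha> M)
    = ennreal (t powr (- \<alpha>) * laplace t)"
proof -
  have "(\<integral>\<^sup>+x. ennreal (indicator {0..} x * exp (- t * x)) \<partial>fractional_integral \<alpha> M)
    = (\<integral>\<^sup>+r. ennreal (t powr (- \<alpha>)) * ennreal (indicator {0..} r * exp (- t * r)) \<partial>M)"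
  proof (subst nn_integral_fractional_integral, measurable, rule nn_integral_cong)
    fix r :: real
    show "indicator {0..} r * (\<integral>\<^sup>+u. ennreal (riesz_kernel \<alpha> u) * ennreal (indicator {0..} (r + u) * exp (- t * (r + u))) \<partial>lborel)
      = ennreal (t powr (- \<alpha>)) * ennreal (indicator {0..} r * exp (- t * r))"
    proof (cases "r \<ge> 0")
      case True
      have "(\<integral>\<^sup>+u. ennreal (riesz_kernel \<alpha> u) * ennreal (indicator {0..} (r + u) * exp (- t * (r + u))) \<partial>lborel)
        = (\<integral>\<^sup>+u. (ennreal (riesz_kernel \<alpha> u) * ennreal (exp (- t * u))) * ennreal (exp (- t * r)) \<partial>lborel)"
      proof (rule nn_integral_cong)
        fix u :: real
        have "ennreal (exp (- t * (r + u))) = ennreal (exp (- t * u)) * ennreal (exp (- t * r))"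
          by (simp add: ennreal_mult'[symmetric] exp_add[symmetric] algebra_simps)
        thus "ennreal (riesz_kernel \<alpha> u) * ennreal (indicator {0..} (r + u) * exp (- t * (r + u)))
          = ennreal (riesz_kernel \<alpha> u) * ennreal (exp (- t * u)) * ennreal (exp (- t * r))"
          using True by (cases "u \<ge> 0") (auto simp: mult.assoc)
      qed
      also have "\<dots> = ennreal (t powr (- \<alpha>)) * ennreal (exp (- t * r))"
        by (subst nn_integral_multc) (use nn_integral_riesz_kernel_exp[OF assms] in auto)
      finally show ?thesis using True by simp
    qed simp
  qed
  also have "\<dots> = ennreal (t powr (- \<alpha>)) * ennreal (laplace t)"
    unfolding ennreal_laplace[OF assms(2)] by (rule nn_integral_cmult) measurable
  finally show ?thesis by (simp add: ennreal_mult')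
qed

lemma laplace_measure_fractional_integral:
  assumes "\<alpha> > 0"
  shows "laplace_measure (fractional_integral \<alpha> M)"
proof
  show s: "sets (fractional_integral \<alpha> M) = sets borel" by (simp add: fractional_integral_def)
  fix t :: real assume "t > 0"
  show "set_integrable (fractional_integral \<alpha> M) {0..} (\<lambda>r. exp (- t * r))"
    unfolding set_integrable_def
  proof (rule integrableI_nonneg)
    show "(\<lambda>x. indicator {0..} x *\<^sub>R exp (- t * x)) \<in> borel_measurable (fractional_integral \<alpha> M)"
      unfolding measurable_cong_sets[OF s refl] by measurable
    show "(\<integral>\<^sup>+x. ennreal (indicator {0..} x *\<^sub>R exp (- t * x)) \<partial>fractional_integral \<alpha> M) < \<infinity>"
      using nn_integral_exp_fractional_integral[OF assms \<open>t > 0\<close>] by simp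
  qed auto
qed

lemma laplace_fractional_integral:
  assumes "\<alpha> > 0" "t > 0"
  shows "laplace_measure.laplace (fractional_integral \<alpha> M) t = t powr (- \<alpha>) * laplace t"
proof -
  interpret N: laplace_measure "fractional_integral \<alpha> M"
    by (rule laplace_measure_fractional_integral) fact
  have "ennreal (N.laplace t) = ennreal (t powr (- \<alpha>) * laplace t)"
    unfolding N.ennreal_laplace[OF assms(2)] by (rule nn_integral_exp_fractional_integral[OF assms])
  thus ?thesis by (simp add: N.laplace_nonneg laplace_nonneg)
qed

text \<open>With the truncated power all values of \<open>L\<close> share the domain
  \<open>{0..}\<close>, so different \<open>L\<close> can be compared pointwise under the
  integral.\<close>

lemma measure_fractional_integral:
  assumes "\<alpha> > 0"
  shows "measure (fractional_integral \<alpha> M) {0..L}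
    = 1 / Gamma (\<alpha> + 1) * (LINT r:{0..}|M. max 0 (L - r) powr \<alpha>)"
proof -
  have G: "Gamma (\<alpha> + 1) > 0" using assms by (simp add: Gamma_real_pos)
  interpret N: laplace_measure "fractional_integral \<alpha> M"
    by (rule laplace_measure_fractional_integral) fact
  have "emeasure (fractional_integral \<alpha> M) {0..L} = (\<integral>\<^sup>+x. indicator {0..L} x \<partial>fractional_integral \<alpha> M)"
    by simp
  also have "\<dots> = (\<integral>\<^sup>+r. ennreal (indicator {0..} r *\<^sub>R (max 0 (L - r) powr \<alpha> / Gamma (\<alpha> + 1))) \<partial>M)"
  proof (subst nn_integral_fractional_integral, measurable, rule nn_integral_cong)
    fix r :: real
    show "indicator {0..} r * (\<integral>\<^sup>+u. ennreal (riesz_kernel \<alpha> u) * indicator {0..L} (r + u) \<partial>lborel)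
      = ennreal (indicator {0..} r *\<^sub>R (max 0 (L - r) powr \<alpha> / Gamma (\<alpha> + 1)))"
      using nn_integral_riesz_kernel_Icc[OF assms, of r L] by (cases "r \<ge> 0") auto
  qed
  finally have "measure (fractional_integral \<alpha> M) {0..L} = (LINT r:{0..}|M. max 0 (L - r) powr \<alpha> / Gamma (\<alpha> + 1))"
    unfolding set_lebesgue_integral_def
    by (subst integral_eq_nn_integral) (use G in \<open>auto simp: measure_def\<close>)
  thus ?thesis by simp
qed

section \<open>Size and regularity of the truncated power integrals\<close>

lemma set_integrable_powr:
  assumes "\<alpha> > 0"
  shows "set_integrable M {0..} (\<lambda>r. max 0 (L - r) powr \<alpha>)"
proof -
  have "set_integrable M {0..} (\<lambda>r. exp (- 1 * r) * (exp r * max 0 (L - r) powr \<alpha>))"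
  proof (rule set_integrable_exp_mult[where B = "exp \<bar>L\<bar> * \<bar>L\<bar> powr \<alpha>"])
    fix r :: real assume "r \<ge> 0"
    thus "\<bar>exp r * max 0 (L - r) powr \<alpha>\<bar> \<le> exp \<bar>L\<bar> * \<bar>L\<bar> powr \<alpha>"
      using assms by (cases "r \<le> L") (auto simp: abs_mult intro!: mult_mono powr_mono2)
  qed auto
  thus ?thesis by (simp add: exp_minus mult.assoc[symmetric])
qed

text \<open>For \<open>r\<close> in \<open>{0..L}\<close> the power of \<open>L - r\<close> is at
  most \<open>L powr \<alpha>\<close>, but it vanishes at \<open>r = L\<close>. The lower bound
  therefore uses \<open>2 * L - r \<ge> L\<close>, a loss that doubling repays.\<close>

lemma
  assumes "\<alpha> > 0" "L \<ge> 0"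
  shows set_integral_powr_le: "(LINT r:{0..}|M. max 0 (L - r) powr \<alpha>) \<le> L powr \<alpha> * measure M {0..L}"
    and set_integral_powr_ge: "L powr \<alpha> * measure M {0..L} \<le> (LINT r:{0..}|M. max 0 (2 * L - r) powr \<alpha>)"
proof -
  have m: "L powr \<alpha> * measure M {0..L} = (LINT r:{0..}|M. L powr \<alpha> * indicator {0..L} r)"
    by (simp add: set_integral_indicator)
  have int: "set_integrable M {0..} (\<lambda>r. L powr \<alpha> * indicator {0..L} r)"
    by (intro set_integrable_mult_right impI set_integrable_indicator)
  show "(LINT r:{0..}|M. max 0 (L - r) powr \<alpha>) \<le> L powr \<alpha> * measure M {0..L}"
    unfolding m
    by (rule set_integral_mono[OF set_integrable_powr int])
       (use assms in \<open>auto simp: indicator_def intro!: powr_mono2\<close>)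
  show "L powr \<alpha> * measure M {0..L} \<le> (LINT r:{0..}|M. max 0 (2 * L - r) powr \<alpha>)"
    unfolding m
    by (rule set_integral_mono[OF int set_integrable_powr])
       (use assms in \<open>auto simp: indicator_def intro!: powr_mono2\<close>)
qed

text \<open>The modulus is used at \<open>y = r / L\<close>; homogeneity of the power turns \<delta>
  into an additive error \<open>\<delta> * L powr \<alpha>\<close>, present only for
  \<open>r \<le> (1 + \<epsilon>) * L\<close>.\<close>

lemma set_integral_powr_dilate_le:
  assumes "\<alpha> > 0" "L > 0"
    and \<delta>: "\<And>y. 0 \<le> y \<Longrightarrow> y \<le> 1 + \<epsilon> \<Longrightarrow> (1 + \<epsilon> - y) powr \<alpha> \<le> max 0 (1 - y) powr \<alpha> + \<delta>"
  shows "(LINT r:{0..}|M. max 0 ((1 + \<epsilon>) * L - r) powr \<alpha>)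
    \<le> (LINT r:{0..}|M. max 0 (L - r) powr \<alpha>) + \<delta> * L powr \<alpha> * measure M {0..(1 + \<epsilon>) * L}"
proof -
  have int: "set_integrable M {0..} (\<lambda>r. \<delta> * L powr \<alpha> * indicator {0..(1 + \<epsilon>) * L} r)"
    by (intro set_integrable_mult_right impI set_integrable_indicator)
  have "(LINT r:{0..}|M. max 0 ((1 + \<epsilon>) * L - r) powr \<alpha>)
    \<le> (LINT r:{0..}|M. max 0 (L - r) powr \<alpha> + \<delta> * L powr \<alpha> * indicator {0..(1 + \<epsilon>) * L} r)"
  proof (rule set_integral_mono[OF set_integrable_powr set_integral_add(1)[OF set_integrable_powr int]])
    fix r :: real assume r: "r \<in> {0..}"
    show "max 0 ((1 + \<epsilon>) * L - r) powr \<alpha> \<le> max 0 (L - r) powr \<alpha> + \<delta> * L powr \<alpha> * indicator {0..(1 + \<epsilon>) * L} r"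
    proof (cases "r \<le> (1 + \<epsilon>) * L")
      case True
      have "(1 + \<epsilon> - r / L) powr \<alpha> \<le> max 0 (1 - r / L) powr \<alpha> + \<delta>"
        using r True assms(2) by (intro \<delta>) (auto simp: field_simps)
      hence "L powr \<alpha> * (1 + \<epsilon> - r / L) powr \<alpha> \<le> L powr \<alpha> * (max 0 (1 - r / L) powr \<alpha> + \<delta>)"
        by (intro mult_left_mono) auto
      also have "L powr \<alpha> * (1 + \<epsilon> - r / L) powr \<alpha> = max 0 ((1 + \<epsilon>) * L - r) powr \<alpha>"
      proof -
        have "max 0 ((1 + \<epsilon>) * L - r) = L * (1 + \<epsilon> - r / L)" "1 + \<epsilon> - r / L \<ge> 0"
          using True assms(2) by (auto simp: field_simps)
        thus ?thesis using assms(2) by (simp add: powr_mult)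
      qed
      also have "L powr \<alpha> * (max 0 (1 - r / L) powr \<alpha> + \<delta>) = max 0 (L - r) powr \<alpha> + \<delta> * L powr \<alpha>"
      proof -
        have "max 0 (L - r) = L * max 0 (1 - r / L)"
          using assms(2) by (auto simp: max_def field_simps)
        thus ?thesis using assms(2) by (simp add: powr_mult algebra_simps)
      qed
      finally show ?thesis using True r by simp
    qed simp
  qed (use assms in auto)
  also have "\<dots> = (LINT r:{0..}|M. max 0 (L - r) powr \<alpha>) + \<delta> * L powr \<alpha> * measure M {0..(1 + \<epsilon>) * L}"
    by (subst set_integral_add(2)[OF set_integrable_powr[OF assms(1)] int]) (simp add: set_integral_indicator)
  finally show ?thesis .
qed

end

text \<open>The two bases differ by at most \<epsilon> and, as \<open>\<epsilon> \<le> 1\<close>,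
  both lie in \<open>{0..2}\<close>. Uniform continuity also covers \<alpha> < 1, where the power is
  not Lipschitz at 0.\<close>

lemma powr_dilate_modulus:
  fixes \<alpha> \<delta> :: real
  assumes "\<alpha> > 0" "\<delta> > 0"
  obtains \<epsilon> where "0 < \<epsilon>" "\<epsilon> \<le> 1"
    "\<And>y. 0 \<le> y \<Longrightarrow> y \<le> 1 + \<epsilon> \<Longrightarrow> (1 + \<epsilon> - y) powr \<alpha> \<le> max 0 (1 - y) powr \<alpha> + \<delta>"
proof -
  have "uniformly_continuous_on {0..2} (\<lambda>x. x powr \<alpha>)"
    using assms by (intro compact_uniformly_continuous continuous_on_powr' continuous_intros) auto
  then obtain d where d: "d > 0"
    "\<And>x y. x \<in> {0..2} \<Longrightarrow> y \<in> {0..2} \<Longrightarrow> dist y x < d \<Longrightarrow> dist (y powr \<alpha>) (x powr \<alpha>) < \<delta>"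
    using assms(2) unfolding uniformly_continuous_on_def by metis
  show thesis
  proof
    show "0 < min 1 (d / 2)" "min 1 (d / 2) \<le> 1" using d by auto
    fix y :: real assume y: "0 \<le> y" "y \<le> 1 + min 1 (d / 2)"
    have "dist ((1 + min 1 (d / 2) - y) powr \<alpha>) (max 0 (1 - y) powr \<alpha>) < \<delta>"
      using y d(1) by (intro d(2)) (auto simp: dist_real_def)
    thus "(1 + min 1 (d / 2) - y) powr \<alpha> \<le> max 0 (1 - y) powr \<alpha> + \<delta>"
      by (simp add: dist_real_def)
  qed
qed

context laplace_measure
begin

context
  fixes \<alpha> C :: real
  assumes \<alpha>: "\<alpha> > 0" and C: "C > 0"
    and doubling: "\<forall>\<^sub>F L in at_top. measure M {0..2 * L} \<le> C * measure M {0..L}"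
begin

text \<open>Two doublings lead from \<open>2 * L\<close> down to \<open>L / 2\<close>, whence the
  square of \<open>C\<close>; the factor \<open>2 powr \<alpha>\<close> is the price of
  \<open>(L / 2) powr \<alpha>\<close>. The mass is taken up to \<open>2 * L\<close> so as to cover
  \<open>(1 + \<epsilon>) * L\<close> later.\<close>

lemma measure_le_set_integral_powr:
  "\<forall>\<^sub>F L in at_top. L powr \<alpha> * measure M {0..2 * L} \<le> 2 powr \<alpha> * C\<^sup>2 * (LINT r:{0..}|M. max 0 (L - r) powr \<alpha>)"
proof -
  have "filterlim (\<lambda>L::real. L / 2) at_top at_top"
    using filterlim_tendsto_pos_mult_at_top[OF tendsto_const[of "1 / 2 :: real"] _ filterlim_ident] by simp
  from eventually_compose_filterlim[OF doubling this] doubling eventually_gt_at_top[of 0]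
  show ?thesis
  proof eventually_elim
    case (elim L)
    have "measure M {0..2 * L} \<le> C * (C * measure M {0..L / 2})"
      using elim C by (intro order.trans[OF elim(2)] mult_left_mono) auto
    hence "L powr \<alpha> * measure M {0..2 * L} \<le> L powr \<alpha> * (C * (C * measure M {0..L / 2}))"
      by (intro mult_left_mono) auto
    also have "\<dots> = 2 powr \<alpha> * C\<^sup>2 * ((L / 2) powr \<alpha> * measure M {0..L / 2})"
      using elim(3) by (simp add: powr_divide power2_eq_square)
    also have "\<dots> \<le> 2 powr \<alpha> * C\<^sup>2 * (LINT r:{0..}|M. max 0 (L - r) powr \<alpha>)"
      using set_integral_powr_ge[OF \<alpha>, of "L / 2"] elim(3) by (intro mult_left_mono) auto
    finally show ?case .
  qed
qed

lemma fractional_integral_doubling: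
  "\<forall>\<^sub>F L in at_top. measure (fractional_integral \<alpha> M) {0..2 * L}
    \<le> (4 powr \<alpha> * C\<^sup>2) * measure (fractional_integral \<alpha> M) {0..L}"
  using measure_le_set_integral_powr eventually_gt_at_top[of 0]
proof eventually_elim
  case (elim L)
  have "(LINT r:{0..}|M. max 0 (2 * L - r) powr \<alpha>) \<le> (2 * L) powr \<alpha> * measure M {0..2 * L}"
    using set_integral_powr_le[OF \<alpha>, of "2 * L"] elim(2) by simp
  also have "\<dots> = 2 powr \<alpha> * (L powr \<alpha> * measure M {0..2 * L})"
    using elim(2) by (simp add: powr_mult)
  also have "\<dots> \<le> 2 powr \<alpha> * (2 powr \<alpha> * C\<^sup>2 * (LINT r:{0..}|M. max 0 (L - r) powr \<alpha>))"
    using elim(1) by (intro mult_left_mono) auto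
  also have "\<dots> = 4 powr \<alpha> * C\<^sup>2 * (LINT r:{0..}|M. max 0 (L - r) powr \<alpha>)"
    using powr_mult[of 2 2 \<alpha>] by simp
  finally show ?case
    unfolding measure_fractional_integral[OF \<alpha>] mult.left_commute[of _ "1 / Gamma (\<alpha> + 1)"]
    using \<alpha> by (intro mult_left_mono) (auto simp: Gamma_real_pos less_imp_le)
qed

lemma fractional_integral_dilate:
  assumes "\<delta> > 0"
  shows "\<exists>\<epsilon>>0. \<forall>\<^sub>F L in at_top. measure (fractional_integral \<alpha> M) {0..(1 + \<epsilon>) * L}
    \<le> (1 + \<delta>) * measure (fractional_integral \<alpha> M) {0..L}"
proof -
  \<comment> \<open>Chosen to cancel the constant of \<open>measure_le_set_integral_powr\<close>,
    which makes the additive error a \<delta>-fraction of the integral itself.\<close>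
  define \<eta> where "\<eta> = \<delta> / (2 powr \<alpha> * C\<^sup>2)"
  have \<eta>: "\<eta> > 0" "\<eta> * (2 powr \<alpha> * C\<^sup>2) = \<delta>" using assms C by (auto simp: \<eta>_def)
  obtain \<epsilon> where \<epsilon>: "0 < \<epsilon>" "\<epsilon> \<le> 1"
    "\<And>y. 0 \<le> y \<Longrightarrow> y \<le> 1 + \<epsilon> \<Longrightarrow> (1 + \<epsilon> - y) powr \<alpha> \<le> max 0 (1 - y) powr \<alpha> + \<eta>"
    using powr_dilate_modulus[OF \<alpha> \<eta>(1)] by blast
  have "\<forall>\<^sub>F L in at_top. measure (fractional_integral \<alpha> M) {0..(1 + \<epsilon>) * L}
    \<le> (1 + \<delta>) * measure (fractional_integral \<alpha> M) {0..L}"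
    using measure_le_set_integral_powr eventually_gt_at_top[of 0]
  proof eventually_elim
    case (elim L)
    have "\<eta> * L powr \<alpha> * measure M {0..(1 + \<epsilon>) * L} \<le> \<eta> * L powr \<alpha> * measure M {0..2 * L}"
      using \<epsilon> \<eta>(1) elim(2) by (intro mult_left_mono measure_Icc_mono mult_right_mono) auto
    also have "\<dots> \<le> \<eta> * (2 powr \<alpha> * C\<^sup>2 * (LINT r:{0..}|M. max 0 (L - r) powr \<alpha>))"
      unfolding mult.assoc[of \<eta>] using \<eta>(1) elim(1) by (intro mult_left_mono) auto
    also have "\<dots> = \<delta> * (LINT r:{0..}|M. max 0 (L - r) powr \<alpha>)"
      by (simp only: mult.assoc[of \<eta>, symmetric] \<eta>(2)[unfolded mult.assoc[of \<eta>, symmetric]])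
    finally have "(LINT r:{0..}|M. max 0 ((1 + \<epsilon>) * L - r) powr \<alpha>)
      \<le> (1 + \<delta>) * (LINT r:{0..}|M. max 0 (L - r) powr \<alpha>)"
      using set_integral_powr_dilate_le[OF \<alpha> elim(2) \<epsilon>(3)] by (simp add: distrib_right)
    thus ?case
      unfolding measure_fractional_integral[OF \<alpha>] mult.left_commute[of _ "1 / Gamma (\<alpha> + 1)"]
      using \<alpha> by (intro mult_left_mono) (auto simp: Gamma_real_pos less_imp_le)
  qed
  thus ?thesis using \<epsilon>(1) by blast
qed

end

end

section \<open>Lebesgue--Stieltjes measures\<close>

context
  fixes \<mu> :: "real \<Rightarrow> real"
  assumes mono: "mono_on {0..} \<mu>"
begin

text \<open>The function inside \<open>LS_measure_def\<close>, kept as an abbreviation so that facts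
  about it match the unfolded measure.\<close>

abbreviation (input) right_reg :: "real \<Rightarrow> real" where
  "right_reg \<equiv> \<lambda>x. if x < 0 then \<mu> 0 else Lim (at_right x) \<mu>"

text \<open>\<open>Lim\<close> is informative only once a limit exists; monotonicity supplies it as
  an infimum over the points to the right.\<close>

lemma tendsto_right_reg:
  assumes "x \<ge> 0"
  shows "(\<mu> \<longlongrightarrow> right_reg x) (at_right x)"
proof -
  have "(\<mu> \<longlongrightarrow> Inf (\<mu> ` ({x<..} \<inter> UNIV))) (at x within ({x<..} \<inter> UNIV))"
    using assms by (intro Lim_right_bound[where K = "\<mu> x"]) (auto intro!: mono_onD[OF mono])
  hence l: "(\<mu> \<longlongrightarrow> Inf (\<mu> ` {x<..})) (at_right x)" by simp
  show ?thesis using tendsto_Lim[OF _ l] l assms by simp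
qed

lemma right_reg_ge:
  assumes "x \<ge> 0" shows "\<mu> x \<le> right_reg x"
  by (rule tendsto_lowerbound[OF tendsto_right_reg[OF assms]])
     (use assms in \<open>auto simp: eventually_at_right_field intro!: exI[of _ "x + 1"] mono_onD[OF mono]\<close>)

lemma right_reg_le:
  assumes "0 \<le> x" "x < y" shows "right_reg x \<le> \<mu> y"
  by (rule tendsto_upperbound[OF tendsto_right_reg[OF assms(1)]])
     (use assms in \<open>auto simp: eventually_at_right_field intro!: exI[of _ y] mono_onD[OF mono]\<close>)

lemma right_reg_mono:
  assumes "x \<le> y" shows "right_reg x \<le> right_reg y"
proof -
  consider "y < 0" | "x < 0" "y \<ge> 0" | "x = y" | "0 \<le> x" "x < y" using assms by linarith
  thus ?thesis
  proof cases
    case 2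
    have "\<mu> 0 \<le> \<mu> y" using 2 by (intro mono_onD[OF mono]) auto
    thus ?thesis using right_reg_ge[OF 2(2)] 2 by simp
  next
    case 4
    show ?thesis using right_reg_le[OF 4] right_reg_ge[of y] 4 by linarith
  qed (use assms in auto)
qed

lemma right_reg_continuous: "continuous (at_right x) right_reg"
  unfolding continuous_within
proof (cases "x < 0")
  case True
  show "(right_reg \<longlongrightarrow> right_reg x) (at_right x)"
  proof (rule tendsto_eventually)
    show "\<forall>\<^sub>F y in at_right x. right_reg y = right_reg x"
      using True unfolding eventually_at_right_field by (intro exI[of _ 0]) auto
  qed
next
  case False
  show "(right_reg \<longlongrightarrow> right_reg x) (at_right x)"
  proof (rule order_tendstoI)
    fix a assume "a < right_reg x"
    thus "\<forall>\<^sub>F y in at_right x. a < right_reg y"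
      using right_reg_mono[of x] unfolding eventually_at_right_field
      by (intro exI[of _ "x + 1"]) (meson less_imp_le less_le_trans less_add_one)
  next
    fix a assume a: "right_reg x < a"
    obtain b where b: "b > x" "\<And>y. x < y \<Longrightarrow> y < b \<Longrightarrow> \<mu> y < a"
      using order_tendstoD(2)[OF tendsto_right_reg a] False unfolding eventually_at_right_field by auto
    \<comment> \<open>The midpoint of \<open>y\<close> and \<open>b\<close> leaves room on both
      sides: its \<mu>-value dominates \<open>right_reg y\<close> and is still below
      \<open>a\<close>.\<close>
    have "right_reg y < a" if "x < y" "y < b" for y
      using right_reg_le[of y "(y + b) / 2"] b(2)[of "(y + b) / 2"] that False by auto
    thus "\<forall>\<^sub>F y in at_right x. right_reg y < a"
      using b(1) unfolding eventually_at_right_field by blast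
  qed
qed

text \<open>Half-open intervals starting at \<open>- (1 / real (Suc n))\<close> shrink to
  \<open>{0..s}\<close>, and all have the same mass because the distribution function is constant on
  the negative axis. The atom at 0 is thereby included.\<close>

lemma measure_LS_measure:
  assumes "s \<ge> 0"
  shows "measure (LS_measure \<mu>) {0..s} = right_reg s - \<mu> 0"
proof -
  let ?A = "\<lambda>n::nat. {- (1 / real (Suc n))<..s}"
  have e: "emeasure (LS_measure \<mu>) (?A n) = ennreal (right_reg s - \<mu> 0)" for n
  proof -
    have "- (1 / real (Suc n)) < 0" by simp
    hence "- (1 / real (Suc n)) \<le> s" using assms by linarith
    thus ?thesis unfolding LS_measure_def
      by (subst emeasure_interval_measure_Ioc[OF _ right_reg_mono right_reg_continuous]) auto
  qed
  have "(\<Inter>n. ?A n) = {0..s}"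
  proof (intro equalityI subsetI)
    fix x assume x: "x \<in> (\<Inter>n. ?A n)"
    have "0 \<le> x"
    proof (rule ccontr)
      assume "\<not> 0 \<le> x"
      then obtain n where "1 / real (Suc n) < - x" using nat_approx_posE[of "- x"] by auto
      with x show False by (auto dest!: spec[of _ n])
    qed
    with x show "x \<in> {0..s}" by auto
  next
    fix x assume "x \<in> {0..s}"
    moreover from this have "- (1 / real (Suc n)) < x" for n
      by (intro less_le_trans[of "- (1 / real (Suc n))" 0 x]) auto
    ultimately show "x \<in> (\<Inter>n. ?A n)" by (simp del: of_nat_Suc)
  qed
  moreover have "(INF n. emeasure (LS_measure \<mu>) (?A n)) = emeasure (LS_measure \<mu>) (\<Inter>n. ?A n)"
  proof (rule INF_emeasure_decseq)
    show "decseq ?A"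
    proof (rule antimonoI)
      fix m n :: nat assume "m \<le> n"
      hence "1 / real (Suc n) \<le> 1 / real (Suc m)" by (intro divide_left_mono) auto
      thus "?A n \<subseteq> ?A m" by auto
    qed
  qed (unfold e, auto simp: LS_measure_def)
  ultimately have "emeasure (LS_measure \<mu>) {0..s} = ennreal (right_reg s - \<mu> 0)"
    by (simp only: e cINF_const[OF UNIV_not_empty])
  moreover have "right_reg s - \<mu> 0 \<ge> 0" using right_reg_mono[of "-1" s] assms by simp
  ultimately show ?thesis unfolding measure_def by (simp only: enn2real_ennreal)
qed

text \<open>The doubling constant changes because the measure of [0,s] is \<mu>(s+) - \<mu>(0), and \<mu>(0) may
  have either sign; if the measure is zero, doubling is trivial.\<close>

lemma LS_measure_doubling:
  assumes doubling: "\<exists>C s0. C > 0 \<and> s0 > 0 \<and> (\<forall>s\<ge>s0. \<mu> (2 * s) \<le> C * \<mu> s)"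
  shows "\<exists>C>0. \<forall>\<^sub>F s in at_top. measure (LS_measure \<mu>) {0..2 * s} \<le> C * measure (LS_measure \<mu>) {0..s}"
proof -
  let ?V = "\<lambda>s. measure (LS_measure \<mu>) {0..s}"
  obtain C s0 where C: "C > 0" "s0 > 0" "\<And>s. s \<ge> s0 \<Longrightarrow> \<mu> (2 * s) \<le> C * \<mu> s"
    using doubling by blast
  \<comment> \<open>For \<open>y > s\<close> one has
    \<open>right_reg (2 * s) \<le> \<mu> (2 * y) \<le> C * \<mu> y\<close>; then \<open>y\<close>
    decreases to \<open>s\<close>.\<close>
  have reg: "right_reg (2 * s) \<le> C * right_reg s" if s: "s \<ge> s0" for s
  proof (rule tendsto_lowerbound)
    show "((\<lambda>y. C * \<mu> y) \<longlongrightarrow> C * right_reg s) (at_right s)"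
      using s C by (intro tendsto_mult_left tendsto_right_reg) auto
    have "right_reg (2 * s) \<le> C * \<mu> y" if "y > s" for y
      using right_reg_le[of "2 * s" "2 * y"] C(3)[of y] C(2) s that by auto
    thus "\<forall>\<^sub>F y in at_right s. right_reg (2 * s) \<le> C * \<mu> y"
      by (auto simp: eventually_at_right_field intro: exI[of _ "s + 1"])
  qed simp
  show ?thesis
  proof (cases "\<exists>s\<ge>s0. ?V s > 0")
    case False
    hence "?V s = 0" if "s \<ge> s0" for s
      using that by (metis measure_nonneg order.not_eq_order_implies_strict)
    hence "\<forall>s\<ge>s0. ?V (2 * s) \<le> 1 * ?V s" using C(2) by simp
    thus ?thesis unfolding eventually_at_top_linorder by (intro exI[of _ 1]) auto
  next
    case True
    then obtain a where a: "a \<ge> s0" "?V a > 0" by blast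
    \<comment> \<open>Beyond \<open>a\<close> the mass is at least \<open>?V a > 0\<close>, so the
      constant excess \<open>(C - 1) * \<mu> 0\<close> is absorbed as a multiple of
      \<open>?V s\<close>.\<close>
    define D where "D = C + \<bar>(C - 1) * \<mu> 0\<bar> / ?V a"
    have "?V (2 * s) \<le> D * ?V s" if s: "s \<ge> a" for s
    proof -
      have "?V s \<ge> ?V a"
        using measure_LS_measure[of s] measure_LS_measure[of a] right_reg_mono[OF s] a s C(2) by simp
      hence "\<bar>(C - 1) * \<mu> 0\<bar> / ?V a * ?V a \<le> \<bar>(C - 1) * \<mu> 0\<bar> / ?V a * ?V s"
        using a(2) by (intro mult_left_mono) auto
      hence "(C - 1) * \<mu> 0 \<le> \<bar>(C - 1) * \<mu> 0\<bar> / ?V a * ?V s" using a(2) by simp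
      moreover have "?V (2 * s) \<le> C * ?V s + (C - 1) * \<mu> 0"
      proof -
        have rr: "right_reg s = ?V s + \<mu> 0" "right_reg (2 * s) = ?V (2 * s) + \<mu> 0"
          using measure_LS_measure[of s] measure_LS_measure[of "2 * s"] a s C(2) by simp_all
        have "?V (2 * s) + \<mu> 0 \<le> C * (?V s + \<mu> 0)"
          using reg[of s] a(1) s unfolding rr by simp
        thus ?thesis by (simp add: algebra_simps)
      qed
      ultimately show ?thesis by (simp add: D_def distrib_right)
    qed
    moreover have "D > 0" using C(1) a(2) by (auto simp: D_def intro!: add_pos_nonneg)
    ultimately show ?thesis unfolding eventually_at_top_linorder by blast
  qed
qed

end

section \<open>The Tauberian theorem\<close>

theorem theorem1p2:
  fixes \<mu> \<nu> :: "real \<Rightarrow> real" and \<alpha> :: real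
  assumes mono_mu: "mono_on {0..} \<mu>"
    and mono_nu: "mono_on {0..} \<nu>"
    and alpha_pos: "\<alpha> > 0"
    and integrable: "\<And>t. t > 0 \<Longrightarrow>
        set_integrable (LS_measure \<mu>) {0..} (\<lambda>r. exp (- t * r)) \<and>
        set_integrable (LS_measure \<nu>) {0..} (\<lambda>r. exp (- t * r))"
    and doubling: "\<exists>C s0. C > 0 \<and> s0 > 0 \<and> (\<forall>s\<ge>s0. \<nu> (2 * s) \<le> C * \<nu> s)"
    and laplace: "(\<lambda>t. LINT r:{0..}|LS_measure \<mu>. exp (- t * r))
        \<sim>[at_right 0] (\<lambda>t. t powr (- \<alpha>) * (LINT r:{0..}|LS_measure \<nu>. exp (- t * r)))"
  shows "(\<lambda>L. LINT r:{0..L}|LS_measure \<mu>. 1)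
        \<sim>[at_top] (\<lambda>L. (1 / Gamma (\<alpha> + 1)) * (LINT r:{0..L}|LS_measure \<nu>. (L - r) powr \<alpha>))"
proof -
  interpret mu: laplace_measure "LS_measure \<mu>"
    by unfold_locales (use integrable in \<open>auto simp: LS_measure_def\<close>)
  interpret nu: laplace_measure "LS_measure \<nu>"
    by unfold_locales (use integrable in \<open>auto simp: LS_measure_def\<close>)
  let ?N = "fractional_integral \<alpha> (LS_measure \<nu>)"
  interpret N: laplace_measure ?N
    using alpha_pos by (rule nu.laplace_measure_fractional_integral)
  obtain C where C: "C > 0"
    "\<forall>\<^sub>F s in at_top. measure (LS_measure \<nu>) {0..2 * s} \<le> C * measure (LS_measure \<nu>) {0..s}"
    using LS_measure_doubling[OF mono_nu doubling] by blast
  have "\<forall>\<^sub>F t in at_right 0. t powr (- \<alpha>) * nu.laplace t = N.laplace t"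
    using eventually_at_right_less
    by eventually_elim (simp add: nu.laplace_fractional_integral[OF alpha_pos])
  hence "(\<lambda>t. t powr (- \<alpha>) * nu.laplace t) \<sim>[at_right 0] N.laplace"
    by (rule asymp_equiv_refl_ev)
  moreover have "mu.laplace \<sim>[at_right 0] (\<lambda>t. t powr (- \<alpha>) * nu.laplace t)"
    using laplace unfolding mu.laplace_def nu.laplace_def .
  ultimately have "mu.laplace \<sim>[at_right 0] N.laplace"
    by (rule asymp_equiv_trans[rotated])
  hence "(\<lambda>L. measure (LS_measure \<mu>) {0..L}) \<sim>[at_top] (\<lambda>L. measure ?N {0..L})"
  proof (rule ratio_tauberian[OF mu.laplace_measure_axioms N.laplace_measure_axioms])
    show "\<exists>C>0. \<forall>\<^sub>F L in at_top. measure ?N {0..2 * L} \<le> C * measure ?N {0..L}"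
      using nu.fractional_integral_doubling[OF alpha_pos C] C(1)
      by (intro exI[of _ "4 powr \<alpha> * C\<^sup>2"]) auto
  qed (rule nu.fractional_integral_dilate[OF alpha_pos C])
  moreover have "(LINT r:{0..L}|LS_measure \<mu>. 1) = measure (LS_measure \<mu>) {0..L}" for L
    by (simp add: set_lebesgue_integral_def)
  \<comment> \<open>Beyond \<open>L\<close> the truncated power is
    \<open>0 powr \<alpha> = 0\<close>, so the integral over \<open>{0..}\<close> reduces to the one
    over \<open>{0..L}\<close>.\<close>
  moreover have "(1 / Gamma (\<alpha> + 1)) * (LINT r:{0..L}|LS_measure \<nu>. (L - r) powr \<alpha>) = measure ?N {0..L}" for L
    unfolding nu.measure_fractional_integral[OF alpha_pos] set_lebesgue_integral_def
    by (intro arg_cong[of _ _ "\<lambda>x. _ * x"] Bochner_Integration.integral_cong) (auto simp: indicator_def)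
  ultimately show ?thesis by (simp only:)
qed

end
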